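(* Consider a multi-commodity transportation network (MTN) and let $\Lambda$ be its stability region. Then every multicommodity dynamical flow network (MDFN) on this MTN with exogenous inflow array $\lambda$ admits a free-flow equilibrium point if and only if $\lambda\in\Lambda$. Moreover, in this case, the free-flow equilibrium point is unique.
   Context: **Network.** $\mathcal G=(\mathcal V,\mathcal E)$ is a nonempty finite directed multigraph; each link (cell) $i\in\mathcal E$ goes from its tail $\sigma_i\in\mathcal V$ to its head $\tau_i\in\mathcal V\setminus\{\sigma_i\}$. A special node $w\in\mathcal V$ represents the external world. On-ramps: $\mathcal R=\{i\in\mathcal E:\sigma_i=w\}$; off-ramps: $\mathcal S=\{i\in\mathcal E:\tau_i=w\}$; adjacent pairs: $\mathcal A=\{(i,j)\in\mathcal E\times\mathcal E:\tau_i=\sigma_j\ne w\}$. $\mathcal K$ is a nonempty finite set of commodities. **MTN.** A multi-commodity transportation network (MTN) consists of $\mathcal G$, $\mathcal K$ and the following data. - For each $i\in\mathcal E\setminus\mathcal R$, a supply function $s_i:\mathbb R_+\to\mathbb R_+$ that is Lipschitz continuous, with $s_i(0)>0$ and $s_i(\xi)\le s_i(\eta)$ for all $\xi\ge\eta\ge0$. - For each $i\in\mathcal E$, $k\in\mathcal K$, a demand function $d_i^{(k)}:\mathbb R_+\to\mathbb R_+$ that is differentiable, with $d_i^{(k)}(0)=0$ and $(d_i^{(k)})'(\xi)>0$ for all $\xi\ge0$. - For each $k\in\mathcal K$, a routing matrix $R^{(k)}\in\mathbb R_+^{\mathcal E\times\mathcal E}$ with $R^{(k)}_{ij}=0$ for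 $(i,j)\notin\mathcal A$; $\sum_{j}R^{(k)}_{ij}=1$ for $i\in\mathcal E\setminus\mathcal S$ and $=0$ for $i\in\mathcal S$; and such that for every $i_0\in\mathcal E$ there are $l\ge0$ and $(i_1,\dots,i_l)\in\mathcal E^l$ with $i_l\in\mathcal S$ and $\prod_{h=1}^lR^{(k)}_{i_{h-1}i_h}>0$ (the empty product is $1$). Consequently $I-R^{(k)}$ is invertible with nonnegative inverse. **MDFN.** The state space is $\mathcal X=\mathbb R_+^{\mathcal E\times\mathcal K}$, with states $x=(x_i^{(k)})$. An exogenous inflow array is $\lambda=(\lambda_i^{(k)})\in\mathbb R_+^{\mathcal E\times\mathcal K}$ with $\lambda_i^{(k)}=0$ for $i\in\mathcal E\setminus\mathcal R$. The free-flow region is $$\mathcal F=\Big\{x\in\mathcal X:\ \sum_{k\in\mathcal K}\sum_{j\in\mathcal E}R^{(k)}_{ji}d_j^{(k)}(x_j^{(k)})<s_i\Big(\sum_{k\in\mathcal K}x_i^{(k)}\Big)\ \ \forall i\in\mathcal E\setminus\mathcal R\Big\}.$$ Given an MTN and an exogenous inflow array $\lambda$, a multicommodity dynamical flow network (MDFN) is a dynamical system on $\mathcal X$ $$\dot x_i^{(k)}=\lambda_i^{(k)}+\sum_{j\in\mathcal E}f_{ji}^{(k)}(x)-z_i^{(k)}(x),\qquad i\in\mathcal E,\ k\in\mathcal K,$$ where $f_{ij}^{(k)}:\mathcal X\to\mathbb R_+$, and $z_i^{(k)}(x)=\sum_jf_{ij}^{(k)}(x)$ if $i\in\mathcal E\setminus\mathcal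 S$, $z_i^{(k)}(x)=d_i^{(k)}(x_i^{(k)})$ if $i\in\mathcal S$, such that for all $x\in\mathcal X$: - $f_{ij}^{(k)}(x)\le R_{ij}^{(k)}d_i^{(k)}(x_i^{(k)})$ for all $i,j\in\mathcal E$, $k\in\mathcal K$; - $\sum_k\sum_jf_{ji}^{(k)}(x)\le s_i(\sum_kx_i^{(k)})$ for all $i\in\mathcal E\setminus\mathcal R$; - if $x\in\mathcal F$, then $f_{ij}^{(k)}(x)=R_{ij}^{(k)}d_i^{(k)}(x_i^{(k)})$ for all $i,j\in\mathcal E$, $k\in\mathcal K$. Well-posedness is taken as given: for every $\bar x\in\mathcal X$ there is a unique solution with $x(0)=\bar x$, defined for all $t\ge0$ and staying in $\mathcal X$; it is denoted $\varphi(t,\bar x)$. **Stability region.** For $i\in\mathcal E\setminus\mathcal R$, the capacity region of cell $i$ is $$\mathcal C_i=\Big\{\zeta\in\mathbb R_+^{\mathcal K}:\ \sum_{k\in\mathcal K}\zeta_k<s_i\Big(\sum_{k\in\mathcal K}(d_i^{(k)})^{-1}(\zeta_k)\Big)\Big\},$$ where membership is understood to include that each $(d_i^{(k)})^{-1}(\zeta_k)$ is defined. The stability region $\Lambda$ of the MTN is the set of inflow vectors $\lambda\in\mathbb R_+^{\mathcal E\times\mathcal K}$ such that $\big(((I-(R^{(k)})^\top)^{-1}\lambda^{(k)})_i\big)_{k\in\mathcal K}\in\mathcal C_i$ for all $i\in\mathcal E\setminus\mathcal R$, where $\lambda^{(k)}=(\lambda_i^{(k)})_{i\in\mathcal E}$.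 **Equilibria.** An equilibrium point is $x^*\in\mathcal X$ with $\varphi(t,x^* )=x^*$ for all $t\ge0$; it is a free-flow equilibrium point if moreover $x^*\in\mathcal F$.
   Formalization: It is additionally assumed that, if λ ∈ Λ, every on-ramp inflow λ_i^(k) (i ∈ R) lies in the range of the demand function d_i^(k); otherwise the claim fails, e.g. for on-ramp demand 1−exp(−ξ) with inflow 2. *)

theory Defs
  imports "HOL-Analysis.Analysis"
begin

text \<open>
  The types \<open>'v\<close>, \<open>'e\<close>, \<open>'k\<close> of class \<open>finite\<close> are the (nonempty, finite) sets of nodes,
  links (cells) and commodities; \<open>tail\<close> and \<open>head\<close> describe the directed multigraph.
  Arrays indexed by cells and commodities have type \<open>real ^ 'k ^ 'e\<close>, so that
  \<open>x $ i $ k\<close> is the entry of cell \<open>i\<close> and commodity \<open>k\<close>, and \<open>column k x\<close>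
  is the vector of all entries of commodity \<open>k\<close>.
  Functions on the nonnegative reals are represented by functions on all reals of which only
  the values on \<open>{0..}\<close> are ever constrained or used; likewise the supply functions of
  on-ramps are unconstrained and unused.
\<close>

record ('v, 'e::finite, 'k) mtn =
  world :: 'v
  tail :: "'e \<Rightarrow> 'v"
  head :: "'e \<Rightarrow> 'v"
  supply_fun :: "'e \<Rightarrow> real \<Rightarrow> real"
  demand_fun :: "'e \<Rightarrow> 'k \<Rightarrow> real \<Rightarrow> real"
  routing :: "'k \<Rightarrow> real ^ 'e ^ 'e"

definition on_ramps :: "('v, 'e::finite, 'k) mtn \<Rightarrow> 'e set" where
  "on_ramps M = {i. tail M i = world M}"

definition off_ramps :: "('v, 'e::finite, 'k) mtn \<Rightarrow> 'e set" where
  "off_ramps M = {i. head M i = world M}"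

definition adjacent :: "('v, 'e::finite, 'k) mtn \<Rightarrow> ('e \<times> 'e) set" where
  "adjacent M = {(i, j). head M i = tail M j \<and> tail M j \<noteq> world M}"

definition supply_function :: "(real \<Rightarrow> real) \<Rightarrow> bool" where
  "supply_function s \<longleftrightarrow>
     (\<forall>\<xi>\<ge>0. 0 \<le> s \<xi>) \<and> (\<exists>L. L-lipschitz_on {0..} s) \<and> 0 < s 0 \<and> antimono_on {0..} s"

text \<open>The derivative at \<open>0\<close> is one-sided.\<close>

definition demand_function :: "(real \<Rightarrow> real) \<Rightarrow> bool" where
  "demand_function d \<longleftrightarrow>
     (\<forall>\<xi>\<ge>0. 0 \<le> d \<xi>) \<and> d 0 = 0 \<and>
     (\<forall>\<xi>\<ge>0. \<exists>D>0. (d has_real_derivative D) (at \<xi> within {0..}))"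

definition routing_matrix ::
    "('v, 'e::finite, 'k) mtn \<Rightarrow> real ^ 'e ^ 'e \<Rightarrow> bool" where
  "routing_matrix M R \<longleftrightarrow>
     (\<forall>i j. 0 \<le> R $ i $ j) \<and>
     (\<forall>i j. (i, j) \<notin> adjacent M \<longrightarrow> R $ i $ j = 0) \<and>
     (\<forall>i. i \<notin> off_ramps M \<longrightarrow> (\<Sum>j\<in>UNIV. R $ i $ j) = 1) \<and>
     (\<forall>i. i \<in> off_ramps M \<longrightarrow> (\<Sum>j\<in>UNIV. R $ i $ j) = 0) \<and>
     (\<forall>i\<^sub>0. \<exists>(l::nat) (p :: nat \<Rightarrow> 'e). p 0 = i\<^sub>0 \<and> p l \<in> off_ramps M \<and>
        (\<Prod>h=1..l. R $ p (h - 1) $ p h) > 0)"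

definition is_MTN :: "('v::finite, 'e::finite, 'k::finite) mtn \<Rightarrow> bool" where
  "is_MTN M \<longleftrightarrow>
     (\<forall>i. head M i \<noteq> tail M i) \<and>
     (\<forall>i. i \<notin> on_ramps M \<longrightarrow> supply_function (supply_fun M i)) \<and>
     (\<forall>i k. demand_function (demand_fun M i k)) \<and>
     (\<forall>k. routing_matrix M (routing M k))"

definition nonneg_arrays :: "(real ^ 'k::finite ^ 'e::finite) set" where
  "nonneg_arrays = {x. \<forall>i k. 0 \<le> x $ i $ k}"

definition exogenous_inflow ::
    "('v, 'e::finite, 'k::finite) mtn \<Rightarrow> real ^ 'k ^ 'e \<Rightarrow> bool" where
  "exogenous_inflow M lam \<longleftrightarrow>
     lam \<in> nonneg_arrays \<and> (\<forall>i k. i \<notin> on_ramps M \<longrightarrow> lam $ i $ k = 0)"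

definition free_flow_region ::
    "('v, 'e::finite, 'k::finite) mtn \<Rightarrow> (real ^ 'k ^ 'e) set" where
  "free_flow_region M = {x \<in> nonneg_arrays. \<forall>i. i \<notin> on_ramps M \<longrightarrow>
     (\<Sum>k\<in>UNIV. \<Sum>j\<in>UNIV. routing M k $ j $ i * demand_fun M j k (x $ j $ k))
       < supply_fun M i (\<Sum>k\<in>UNIV. x $ i $ k)}"

text \<open>
  A flow assignment \<open>f\<close> gives the flow \<open>f x i j k\<close> of commodity \<open>k\<close> from cell \<open>i\<close>
  to cell \<open>j\<close> in state \<open>x\<close>; only its values at states in \<open>nonneg_arrays\<close> matter.
\<close>

type_synonym ('e, 'k) flows = "real ^ 'k ^ 'e \<Rightarrow> 'e \<Rightarrow> 'e \<Rightarrow> 'k \<Rightarrow> real"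

definition outflow ::
    "('v, 'e::finite, 'k::finite) mtn \<Rightarrow> ('e, 'k) flows \<Rightarrow> real ^ 'k ^ 'e \<Rightarrow> 'e \<Rightarrow> 'k \<Rightarrow> real" where
  "outflow M f x i k =
     (if i \<in> off_ramps M then demand_fun M i k (x $ i $ k) else (\<Sum>j\<in>UNIV. f x i j k))"

definition vector_field ::
    "('v, 'e::finite, 'k::finite) mtn \<Rightarrow> real ^ 'k ^ 'e \<Rightarrow> ('e, 'k) flows
      \<Rightarrow> real ^ 'k ^ 'e \<Rightarrow> real ^ 'k ^ 'e" where
  "vector_field M lam f x =
     (\<chi> i k. lam $ i $ k + (\<Sum>j\<in>UNIV. f x j i k) - outflow M f x i k)"

definition is_MDFN ::
    "('v, 'e::finite, 'k::finite) mtn \<Rightarrow> real ^ 'k ^ 'e \<Rightarrow> ('e, 'k) flows \<Rightarrow> bool" where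
  "is_MDFN M lam f \<longleftrightarrow> exogenous_inflow M lam \<and>
     (\<forall>x\<in>nonneg_arrays.
        (\<forall>i j k. 0 \<le> f x i j k) \<and>
        (\<forall>i j k. f x i j k \<le> routing M k $ i $ j * demand_fun M i k (x $ i $ k)) \<and>
        (\<forall>i. i \<notin> on_ramps M \<longrightarrow>
           (\<Sum>k\<in>UNIV. \<Sum>j\<in>UNIV. f x j i k) \<le> supply_fun M i (\<Sum>k\<in>UNIV. x $ i $ k)) \<and>
        (x \<in> free_flow_region M \<longrightarrow>
           (\<forall>i j k. f x i j k = routing M k $ i $ j * demand_fun M i k (x $ i $ k))))"

definition solution_from ::
    "('v, 'e::finite, 'k::finite) mtn \<Rightarrow> real ^ 'k ^ 'e \<Rightarrow> ('e, 'k) flows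
      \<Rightarrow> real ^ 'k ^ 'e \<Rightarrow> (real \<Rightarrow> real ^ 'k ^ 'e) \<Rightarrow> bool" where
  "solution_from M lam f x0 y \<longleftrightarrow> y 0 = x0 \<and>
     (\<forall>t\<ge>0. y t \<in> nonneg_arrays \<and>
        (y has_vector_derivative vector_field M lam f (y t)) (at t within {0..}))"

definition well_posed ::
    "('v, 'e::finite, 'k::finite) mtn \<Rightarrow> real ^ 'k ^ 'e \<Rightarrow> ('e, 'k) flows \<Rightarrow> bool" where
  "well_posed M lam f \<longleftrightarrow> (\<forall>x0\<in>nonneg_arrays.
     (\<exists>y. solution_from M lam f x0 y) \<and>
     (\<forall>y y'. solution_from M lam f x0 y \<and> solution_from M lam f x0 y' \<longrightarrow>
        (\<forall>t\<ge>0. y t = y' t)))"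

text \<open>
  The value at time \<open>t \<ge> 0\<close> of the solution starting at \<open>x0\<close>, meaningful when \<open>well_posed\<close>.
  Solutions are unique only on \<open>{0..}\<close>, so the description is of the value, not of the solution.
\<close>

definition semiflow ::
    "('v, 'e::finite, 'k::finite) mtn \<Rightarrow> real ^ 'k ^ 'e \<Rightarrow> ('e, 'k) flows
      \<Rightarrow> real \<Rightarrow> real ^ 'k ^ 'e \<Rightarrow> real ^ 'k ^ 'e" where
  "semiflow M lam f t x0 = (THE v. \<exists>y. solution_from M lam f x0 y \<and> y t = v)"

definition equilibrium ::
    "('v, 'e::finite, 'k::finite) mtn \<Rightarrow> real ^ 'k ^ 'e \<Rightarrow> ('e, 'k) flows
      \<Rightarrow> real ^ 'k ^ 'e \<Rightarrow> bool" where
  "equilibrium M lam f x \<longleftrightarrow> x \<in> nonneg_arrays \<and> (\<forall>t\<ge>0. semiflow M lam f t x = x)"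

definition free_flow_equilibrium ::
    "('v, 'e::finite, 'k::finite) mtn \<Rightarrow> real ^ 'k ^ 'e \<Rightarrow> ('e, 'k) flows
      \<Rightarrow> real ^ 'k ^ 'e \<Rightarrow> bool" where
  "free_flow_equilibrium M lam f x \<longleftrightarrow> equilibrium M lam f x \<and> x \<in> free_flow_region M"

text \<open>
  Demand functions are strictly increasing on \<open>{0..}\<close> but may be bounded. Their inverses are
  therefore defined exactly on the image of \<open>{0..}\<close>, whence the membership condition.
\<close>

definition capacity_region ::
    "('v, 'e::finite, 'k::finite) mtn \<Rightarrow> 'e \<Rightarrow> (real ^ 'k) set" where
  "capacity_region M i = {\<zeta>.
     (\<forall>k. 0 \<le> \<zeta> $ k) \<and> (\<forall>k. \<zeta> $ k \<in> demand_fun M i k ` {0..}) \<and>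
     (\<Sum>k\<in>UNIV. \<zeta> $ k) < supply_fun M i (\<Sum>k\<in>UNIV. inv_into {0..} (demand_fun M i k) (\<zeta> $ k))}"

definition stability_region ::
    "('v, 'e::finite, 'k::finite) mtn \<Rightarrow> (real ^ 'k ^ 'e) set" where
  "stability_region M = {lam \<in> nonneg_arrays. \<forall>i. i \<notin> on_ramps M \<longrightarrow>
     (\<chi> k. (matrix_inv (mat 1 - transpose (routing M k)) *v column k lam) $ i)
       \<in> capacity_region M i}"

text \<open>
  The stability region constrains only cells that are not on-ramps. At an equilibrium an on-ramp
  has to discharge its whole inflow, which is impossible when its demand function
  is bounded by that inflow: with a single on-ramp of demand \<open>1 - exp (- \<xi>)\<close> and inflow \<open>2\<close>,
  feeding a single off-ramp of demand \<open>\<xi>\<close> and constant supply \<open>10\<close>, the inflow is in the stability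
  region although there is no equilibrium. The next predicate excludes exactly this.
\<close>

definition on_ramp_inflow_attainable ::
    "('v, 'e::finite, 'k::finite) mtn \<Rightarrow> real ^ 'k ^ 'e \<Rightarrow> bool" where
  "on_ramp_inflow_attainable M lam \<longleftrightarrow>
     (\<forall>i\<in>on_ramps M. \<forall>k. lam $ i $ k \<in> demand_fun M i k ` {0..})"

end

theory Submission
  imports Defs
begin

text \<open>
  In the free-flow region the dynamics decouple. Every cell discharges its full demand, so the
  vector field vanishes at \<open>x\<close> exactly when, for each commodity \<open>k\<close>, the vector of demands
  \<open>z = (d\<^sub>i(x\<^sub>i))\<^sub>i\<close> satisfies the linear balance \<open>z = \<lambda> + R\<^sup>T z\<close>. Since every cell leads to an
  off-ramp along positive routing entries, \<open>I - R\<close> is invertible (a maximum principle,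
  \<open>routing_matrix_invertible\<close>), hence the demands at a free-flow equilibrium are forced to be
  \<open>(I - R\<^sup>T)\<^sup>-\<^sup>1 \<lambda>\<close>. As demand functions are strictly increasing, this determines \<open>x\<close>, which gives
  uniqueness.

  It remains to compare the two conditions at a state whose demands have this value
  (\<open>free_flow_iff_stable\<close>). A cell that is not an on-ramp has no exogenous inflow, so the balance
  equation says that its total inflow, which the free-flow region compares with the supply, equals
  its total demand, which the capacity region compares with the supply. Conversely, for \<open>\<lambda>\<close> in
  the stability region such a state exists: the required demands lie in the range of the demand
  functions, by the definition of the capacity region at cells that are not on-ramps, and because
  they equal the attainable exogenous inflow at on-ramps, which no other cell feeds.
\<close>

section \<open>Demand functions\<close>

lemma demand_function_strict_mono_on:
  assumes "demand_function d"
  shows "strict_mono_on {0..} d"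
proof (rule strict_mono_onI)
  fix a b :: real
  assume ab: "a \<in> {0..}" "b \<in> {0..}" "a < b"
  have D: "\<exists>D>0. (d has_real_derivative D) (at \<xi> within {0..})" if "\<xi> \<ge> 0" for \<xi>
    using assms that unfolding demand_function_def by blast
  show "d a < d b"
  proof (rule DERIV_pos_imp_increasing_open[OF \<open>a < b\<close>])
    fix \<xi> assume "a < \<xi>" "\<xi> < b"
    then have "\<xi> > 0" using ab by simp
    then have "at \<xi> within {0..} = at \<xi>"
      by (intro at_within_interior) simp
    then show "\<exists>y. (d has_real_derivative y) (at \<xi>) \<and> 0 < y"
      using D[of \<xi>] \<open>\<xi> > 0\<close> by auto
  next
    have "continuous_on {0..} d"
      using D DERIV_continuous by (metis atLeast_iff continuous_on_eq_continuous_within)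
    then show "continuous_on {a..b} d"
      by (rule continuous_on_subset) (use ab in auto)
  qed
qed

lemma demand_function_inj_on: "demand_function d \<Longrightarrow> inj_on d {0..}"
  by (rule strict_mono_on_imp_inj_on) (rule demand_function_strict_mono_on)

section \<open>Invertibility of the routing balance\<close>

text \<open>
  A maximum principle: if \<open>v = R v\<close>, then \<open>\<bar>v\<bar>\<close> is at each cell at most its weighted average over
  the successors, with weights of sum at most 1. So the maximum of \<open>\<bar>v\<bar>\<close> propagates along
  positive routing entries and reaches an off-ramp, where \<open>R v\<close> vanishes.
\<close>

lemma routing_fixed_point_zero:
  assumes R: "routing_matrix M R" and fixpoint: "R *v v = v"
  shows "v = 0"
proof -
  have nonneg: "0 \<le> R $ i $ j" for i j
    using R unfolding routing_matrix_def by blast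
  have row: "(\<Sum>j\<in>UNIV. R $ i $ j) = 1" if "i \<notin> off_ramps M" for i
    using R that unfolding routing_matrix_def by blast
  have row0: "(\<Sum>j\<in>UNIV. R $ i $ j) = 0" if "i \<in> off_ramps M" for i
    using R that unfolding routing_matrix_def by blast
  have v: "v $ i = (\<Sum>j\<in>UNIV. R $ i $ j * v $ j)" for i
    using arg_cong[OF fixpoint, of "\<lambda>u. u $ i"] by (simp add: matrix_vector_mult_def)
  have off: "v $ i = 0" if "i \<in> off_ramps M" for i
  proof -
    have "R $ i $ j = 0" for j
      using row0[OF that] nonneg sum_nonneg_eq_0_iff[of UNIV "\<lambda>j. R $ i $ j"] by simp
    then show ?thesis using v[of i] by simp
  qed
  define m where "m = Max (range (\<lambda>i. \<bar>v $ i\<bar>))"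
  have le_m: "\<bar>v $ i\<bar> \<le> m" for i
    unfolding m_def by (rule Max_ge) auto
  have "m \<in> range (\<lambda>i. \<bar>v $ i\<bar>)"
    unfolding m_def by (rule Max_in) auto
  then obtain i0 where i0: "\<bar>v $ i0\<bar> = m" by auto
  have step: "\<bar>v $ j\<bar> = m" if i: "\<bar>v $ i\<bar> = m" and pos: "R $ i $ j > 0" for i j
  proof (rule ccontr)
    assume "\<bar>v $ j\<bar> \<noteq> m"
    then have "\<bar>v $ j\<bar> < m" using le_m[of j] by simp
    have "i \<notin> off_ramps M"
      using row0[of i] pos nonneg sum_nonneg_eq_0_iff[of UNIV "\<lambda>j. R $ i $ j"] by force
    have "m \<le> (\<Sum>j\<in>UNIV. R $ i $ j * \<bar>v $ j\<bar>)"
      using v[of i] i sum_abs[of "\<lambda>j. R $ i $ j * v $ j" UNIV] nonneg by (simp add: abs_mult)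
    also have "\<dots> < (\<Sum>j\<in>UNIV. R $ i $ j * m)"
      using nonneg le_m pos \<open>\<bar>v $ j\<bar> < m\<close>
      by (intro sum_strict_mono_ex1) (auto intro!: mult_left_mono exI[of _ j])
    also have "\<dots> = m"
      using row[OF \<open>i \<notin> off_ramps M\<close>] by (simp flip: sum_distrib_right)
    finally show False by simp
  qed
  obtain l :: nat and p where p: "p 0 = i0" "p l \<in> off_ramps M"
    and prod: "(\<Prod>h=1..l. R $ p (h - 1) $ p h) > 0"
    using R unfolding routing_matrix_def by meson
  have edge: "R $ p (h - 1) $ p h > 0" if "h \<in> {1..l}" for h
  proof -
    have "R $ p (h - 1) $ p h \<noteq> 0"
    proof
      assume "R $ p (h - 1) $ p h = 0"
      then have "(\<Prod>h=1..l. R $ p (h - 1) $ p h) = 0"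
        using that by (intro prod_zero) auto
      with prod show False by linarith
    qed
    then show ?thesis using nonneg by (simp add: less_le)
  qed
  have "\<bar>v $ p h\<bar> = m" if "h \<le> l" for h
    using that
  proof (induction h)
    case 0
    then show ?case using i0 p by simp
  next
    case (Suc h)
    then show ?case using step[of "p h" "p (Suc h)"] edge[of "Suc h"] by simp
  qed
  then have "m = 0" using off[OF p(2)] by force
  then show "v = 0" using le_m by (simp add: vec_eq_iff)
qed

lemma routing_matrix_invertible:
  assumes "routing_matrix M R"
  shows "invertible (mat 1 - transpose R)"
proof -
  have "invertible (mat 1 - R)"
    unfolding invertible_left_inverse matrix_left_invertible_ker
    using routing_fixed_point_zero[OF assms]
    by (auto simp: matrix_vector_mult_diff_rdistrib)
  then have "invertible (transpose (mat 1 - R))"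
    by (rule transpose_invertible)
  moreover have "transpose (mat 1 - R) = mat 1 - transpose R"
    by (simp add: transpose_def mat_def vec_eq_iff)
  ultimately show ?thesis by simp
qed

lemma invertible_mult_eq_iff:
  fixes A :: "real ^ 'n ^ 'n"
  assumes "invertible A"
  shows "A *v z = b \<longleftrightarrow> z = matrix_inv A *v b"
proof -
  have "A ** matrix_inv A = mat 1 \<and> matrix_inv A ** A = mat 1"
    unfolding matrix_inv_def by (rule someI_ex) (use assms in \<open>simp add: invertible_def\<close>)
  then show ?thesis
    by (metis matrix_vector_mul_assoc matrix_vector_mul_lid)
qed

section \<open>Equilibria and balanced demands\<close>

text \<open>
  Well-posedness lets equilibria, which are defined through the flow, be read off the vector
  field. The trajectory from an equilibrium is constant on \<open>{0..}\<close>, and its derivative at \<open>0\<close> is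
  the vector field at \<open>x\<close>; conversely, at a zero of the vector field the constant function is a
  solution, hence the only one.
\<close>

lemma equilibrium_iff_vector_field_zero:
  assumes wp: "well_posed M lam f" and x: "x \<in> nonneg_arrays"
  shows "equilibrium M lam f x \<longleftrightarrow> vector_field M lam f x = 0"
proof -
  have semiflow: "semiflow M lam f t x = y t" if "solution_from M lam f x y" "t \<ge> 0" for y t
    unfolding semiflow_def
    using wp x that unfolding well_posed_def by (intro the_equality) blast+
  show ?thesis
  proof
    assume eq: "equilibrium M lam f x"
    obtain y where y: "solution_from M lam f x y"
      using wp x unfolding well_posed_def by blast
    have const: "y t = x" if "t \<ge> 0" for t
      using semiflow[OF y that] eq that unfolding equilibrium_def by simp
    have "(y has_vector_derivative vector_field M lam f x) (at 0 within {0..})"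
      using y const[of 0] unfolding solution_from_def by force
    then have "((\<lambda>t. x) has_vector_derivative vector_field M lam f x) (at 0 within {0..})"
      by (rule has_vector_derivative_transform[rotated 2]) (use const in auto)
    moreover have "((\<lambda>t. x) has_vector_derivative 0) (at 0 within {0..})"
      by (rule has_vector_derivative_const)
    moreover have "at (0::real) within {0..} \<noteq> bot"
      by (simp add: at_within_Ici_at_right)
    ultimately show "vector_field M lam f x = 0"
      using vector_derivative_unique_within by blast
  next
    assume "vector_field M lam f x = 0"
    then have "solution_from M lam f x (\<lambda>t. x)"
      using x unfolding solution_from_def by simp
    then show "equilibrium M lam f x"
      using semiflow x unfolding equilibrium_def by blast
  qed
qed

text \<open>
  For each commodity this is the unique solution \<open>z\<close> of the linear balance \<open>z = \<lambda> + R\<^sup>T z\<close>: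
  the flow through each cell when nothing accumulates anywhere.
\<close>

definition balanced_discharge ::
    "('v, 'e::finite, 'k::finite) mtn \<Rightarrow> real ^ 'k ^ 'e \<Rightarrow> 'e \<Rightarrow> 'k \<Rightarrow> real" where
  "balanced_discharge M lam i k =
     (matrix_inv (mat 1 - transpose (routing M k)) *v column k lam) $ i"

lemma eq_balanced_discharge_iff:
  assumes mtn: "is_MTN M"
  shows "(\<forall>i. z i = balanced_discharge M lam i k) \<longleftrightarrow>
    (\<forall>i. z i = lam $ i $ k + (\<Sum>j\<in>UNIV. routing M k $ j $ i * z j))"
proof -
  let ?A = "mat 1 - transpose (routing M k)"
  have inv: "invertible ?A"
    using mtn routing_matrix_invertible unfolding is_MTN_def by blast
  have "(\<forall>i. z i = balanced_discharge M lam i k) \<longleftrightarrow>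
      (\<chi> i. z i) = matrix_inv ?A *v column k lam"
    by (simp add: vec_eq_iff balanced_discharge_def)
  also have "\<dots> \<longleftrightarrow> ?A *v (\<chi> i. z i) = column k lam"
    by (rule invertible_mult_eq_iff[OF inv, symmetric])
  also have "\<dots> \<longleftrightarrow> (\<forall>i. z i - (\<Sum>j\<in>UNIV. routing M k $ j $ i * z j) = lam $ i $ k)"
    by (simp add: matrix_vector_mult_diff_rdistrib vec_eq_iff column_def)
       (simp add: vector_matrix_mult_def mult.commute)
  also have "\<dots> \<longleftrightarrow> (\<forall>i. z i = lam $ i $ k + (\<Sum>j\<in>UNIV. routing M k $ j $ i * z j))"
    by (auto simp: algebra_simps)
  finally show ?thesis .
qed

lemma balanced_discharge_eq:
  assumes "is_MTN M"
  shows "balanced_discharge M lam i k =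
    lam $ i $ k + (\<Sum>j\<in>UNIV. routing M k $ j $ i * balanced_discharge M lam j k)"
  using eq_balanced_discharge_iff[OF assms, where z = "\<lambda>i. balanced_discharge M lam i k"]
  by blast

text \<open>No cell routes flow into an on-ramp, so an on-ramp discharges just its exogenous inflow.\<close>

lemma balanced_discharge_on_ramp:
  assumes mtn: "is_MTN M" and i: "i \<in> on_ramps M"
  shows "balanced_discharge M lam i k = lam $ i $ k"
proof -
  have "(j, i) \<notin> adjacent M" for j
    using i by (simp add: adjacent_def on_ramps_def)
  then have "routing M k $ j $ i = 0" for j
    using mtn unfolding is_MTN_def routing_matrix_def by blast
  then show ?thesis
    using balanced_discharge_eq[OF mtn, of lam i k] by simp
qed

text \<open>
  In free flow, cells that are not off-ramps also discharge their full demand, because the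
  rows of the routing matrix sum to 1 there. So the vector field is affine in the demands, and its
  vanishing is the linear balance.
\<close>

lemma free_flow_equilibrium_iff:
  assumes mtn: "is_MTN M" and mdfn: "is_MDFN M lam f" and wp: "well_posed M lam f"
  shows "free_flow_equilibrium M lam f x \<longleftrightarrow> x \<in> free_flow_region M \<and>
    (\<forall>i k. demand_fun M i k (x $ i $ k) = balanced_discharge M lam i k)"
proof (cases "x \<in> free_flow_region M")
  case True
  let ?d = "\<lambda>i k. demand_fun M i k (x $ i $ k)"
  have x: "x \<in> nonneg_arrays"
    using True unfolding free_flow_region_def by blast
  have flow: "f x i j k = routing M k $ i $ j * ?d i k" for i j k
    using mdfn x True unfolding is_MDFN_def by blast
  have out: "outflow M f x i k = ?d i k" for i k
  proof (cases "i \<in> off_ramps M")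
    case False
    then have "(\<Sum>j\<in>UNIV. routing M k $ i $ j) = 1"
      using mtn unfolding is_MTN_def routing_matrix_def by blast
    then show ?thesis
      using False by (simp add: outflow_def flow flip: sum_distrib_right)
  qed (simp add: outflow_def)
  have balance: "vector_field M lam f x $ i $ k = 0 \<longleftrightarrow>
      ?d i k = lam $ i $ k + (\<Sum>j\<in>UNIV. routing M k $ j $ i * ?d j k)" for i k
    by (simp only: vector_field_def vec_lambda_beta flow out) linarith
  have "free_flow_equilibrium M lam f x \<longleftrightarrow> vector_field M lam f x = 0"
    using True equilibrium_iff_vector_field_zero[OF wp x]
    unfolding free_flow_equilibrium_def by blast
  also have "\<dots> \<longleftrightarrow>
      (\<forall>k i. ?d i k = lam $ i $ k + (\<Sum>j\<in>UNIV. routing M k $ j $ i * ?d j k))"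
    by (simp only: vec_eq_iff zero_index balance) blast
  also have "\<dots> \<longleftrightarrow> (\<forall>k i. ?d i k = balanced_discharge M lam i k)"
    using eq_balanced_discharge_iff[OF mtn, where lam = lam and z = "\<lambda>i. ?d i k" for k] by blast
  finally show ?thesis using True by blast
qed (simp add: free_flow_equilibrium_def)

section \<open>Stability region and free-flow region\<close>

text \<open>
  Balance turns one region into the other: at a cell without exogenous inflow the routed
  inflow equals the discharge, and the inverse demand functions recover the state from the
  discharge, so that both regions compare the same quantity with the same value of the supply.
\<close>

lemma free_flow_iff_stable:
  assumes mtn: "is_MTN M" and lam: "exogenous_inflow M lam" and x: "x \<in> nonneg_arrays"
    and bal: "\<And>i k. demand_fun M i k (x $ i $ k) = balanced_discharge M lam i k"
  shows "x \<in> free_flow_region M \<longleftrightarrow> lam \<in> stability_region M"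
proof -
  have x0: "x $ i $ k \<in> {0..}" for i k
    using x unfolding nonneg_arrays_def by simp
  have d: "demand_function (demand_fun M i k)" for i k
    using mtn unfolding is_MTN_def by blast
  have nonneg: "0 \<le> balanced_discharge M lam i k" for i k
    using d[of i k] x0[of i k] unfolding bal[symmetric] demand_function_def by simp
  have range: "balanced_discharge M lam i k \<in> demand_fun M i k ` {0..}" for i k
    unfolding bal[symmetric] using x0 by (rule imageI)
  have inverse: "inv_into {0..} (demand_fun M i k) (balanced_discharge M lam i k) = x $ i $ k"
    for i k
    unfolding bal[symmetric] by (rule inv_into_f_f[OF demand_function_inj_on[OF d] x0])
  have inflow: "(\<Sum>j\<in>UNIV. routing M k $ j $ i * demand_fun M j k (x $ j $ k)) =
      balanced_discharge M lam i k" if "i \<notin> on_ramps M" for i k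
    using balanced_discharge_eq[OF mtn, of lam i k] lam that
    by (simp add: bal exogenous_inflow_def)
  have capacity: "(\<chi> k. balanced_discharge M lam i k) \<in> capacity_region M i \<longleftrightarrow>
      (\<Sum>k\<in>UNIV. balanced_discharge M lam i k) < supply_fun M i (\<Sum>k\<in>UNIV. x $ i $ k)" for i
    using nonneg range by (simp add: capacity_region_def inverse)
  have "lam \<in> nonneg_arrays"
    using lam unfolding exogenous_inflow_def by blast
  then show ?thesis
    using x inflow capacity
    by (simp add: free_flow_region_def stability_region_def flip: balanced_discharge_def)
qed

text \<open>
  This is where existence could fail, since a bounded demand function cannot discharge a large
  flow. The capacity region rules this out at interior cells and off-ramps, but says nothing about
  on-ramps; there the discharge is the exogenous inflow itself.
\<close>

lemma stable_discharge_attainable: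
  assumes mtn: "is_MTN M" and stable: "lam \<in> stability_region M"
    and attainable: "on_ramp_inflow_attainable M lam"
  shows "balanced_discharge M lam i k \<in> demand_fun M i k ` {0..}"
proof (cases "i \<in> on_ramps M")
  case True
  then show ?thesis
    using attainable balanced_discharge_on_ramp[OF mtn True]
    by (simp add: on_ramp_inflow_attainable_def)
next
  case False
  then have "(\<chi> k. balanced_discharge M lam i k) \<in> capacity_region M i"
    using stable by (simp add: stability_region_def balanced_discharge_def)
  then show ?thesis by (simp add: capacity_region_def)
qed

section \<open>Free-flow equilibria\<close>

theorem proposition1:
  fixes M :: "('v::finite, 'e::finite, 'k::finite) mtn"
    and lam :: "real ^ 'k ^ 'e"
    and f :: "('e, 'k) flows"
  assumes mtn: "is_MTN M"
    and mdfn: "is_MDFN M lam f"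
    and wp: "well_posed M lam f"
    and attainable: "lam \<in> stability_region M \<Longrightarrow> on_ramp_inflow_attainable M lam"
  shows "((\<exists>x. free_flow_equilibrium M lam f x) \<longleftrightarrow> lam \<in> stability_region M) \<and>
         (lam \<in> stability_region M \<longrightarrow> (\<exists>!x. free_flow_equilibrium M lam f x))"
proof -
  note equilibrium_iff = free_flow_equilibrium_iff[OF mtn mdfn wp]
  have lam: "exogenous_inflow M lam"
    using mdfn unfolding is_MDFN_def by blast
  have nonneg: "x \<in> nonneg_arrays" if "free_flow_equilibrium M lam f x" for x
    using that unfolding free_flow_equilibrium_def equilibrium_def by blast
  have necessary: "lam \<in> stability_region M" if "free_flow_equilibrium M lam f x" for x
    using that nonneg[OF that] free_flow_iff_stable[OF mtn lam]
    unfolding equilibrium_iff by blast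
  have sufficient: "\<exists>x. free_flow_equilibrium M lam f x" if stable: "lam \<in> stability_region M"
  proof -
    define x :: "real ^ 'k ^ 'e" where
      "x = (\<chi> i k. inv_into {0..} (demand_fun M i k) (balanced_discharge M lam i k))"
    note range = stable_discharge_attainable[OF mtn stable attainable[OF stable]]
    have "x \<in> nonneg_arrays"
      using inv_into_into[OF range] by (simp add: nonneg_arrays_def x_def)
    moreover have "demand_fun M i k (x $ i $ k) = balanced_discharge M lam i k" for i k
      by (simp add: x_def f_inv_into_f[OF range])
    ultimately show ?thesis
      using free_flow_iff_stable[OF mtn lam] stable unfolding equilibrium_iff by blast
  qed
  have unique: "x = y"
    if x: "free_flow_equilibrium M lam f x" and y: "free_flow_equilibrium M lam f y" for x y
  proof -
    have "x $ i $ k = y $ i $ k" for i k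
    proof (rule inj_onD)
      show "inj_on (demand_fun M i k) {0..}"
        using mtn demand_function_inj_on unfolding is_MTN_def by blast
      show "demand_fun M i k (x $ i $ k) = demand_fun M i k (y $ i $ k)"
        using x y unfolding equilibrium_iff by simp
    qed (use nonneg[OF x] nonneg[OF y] in \<open>auto simp: nonneg_arrays_def\<close>)
    then show ?thesis by (simp add: vec_eq_iff)
  qed
  show ?thesis
    using necessary sufficient unique by blast
qed

end
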